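(* Let $\lambda\ge2$, $0<p\le1$, and let $m_n:=\mathbb{E}(g_n)$ be the expected value of the $n$-th term of a $(p,\lambda)$-random Fibonacci sequence $(g_n)_{n\ge1}$ with positive initial terms $g_1,g_2$. Then $$\lim_{n\to\infty}\frac{m_{n+1}}{m_n}=\frac{\lambda+\sqrt{\lambda^2+4(2p-1)}}{2}.$$
   Context: For $p\in[0,1]$ and a real number $\lambda$, a $(p,\lambda)$-random Fibonacci sequence is a random sequence $(g_n)_{n\ge1}$ whose first two terms $g_1,g_2$ are fixed (deterministic) positive real numbers and which satisfies, for $n\ge3$, $g_n=|\lambda g_{n-1}\pm g_{n-2}|$, where for each $n$ the $\pm$ sign is chosen by an independent coin toss: $+$ with probability $p$ and $-$ with probability $1-p$. *)

theory Defs
  imports "HOL-Probability.Probability"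
begin

text \<open>
  Terms are indexed from 1; the value of \<open>g 0\<close> is unconstrained and irrelevant.
  The event \<open>coin n\<close> means that the sign \<open>+\<close> is chosen in the step producing \<open>g n\<close>, \<open>n \<ge> 3\<close>.
\<close>

locale random_fibonacci = prob_space M for M :: "'a measure" +
  fixes p lam a b :: real
    and coin :: "nat \<Rightarrow> 'a \<Rightarrow> bool"
    and g :: "nat \<Rightarrow> 'a \<Rightarrow> real"
  assumes p_range: "0 \<le> p" "p \<le> 1"
    and initial_pos: "0 < a" "0 < b"
    and indep_coin: "indep_vars (\<lambda>_. count_space UNIV) coin {3..}"
    and prob_coin: "\<And>n. 3 \<le> n \<Longrightarrow> prob {\<omega> \<in> space M. coin n \<omega>} = p"
    and g_1: "\<And>\<omega>. \<omega> \<in> space M \<Longrightarrow> g 1 \<omega> = a"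
    and g_2: "\<And>\<omega>. \<omega> \<in> space M \<Longrightarrow> g 2 \<omega> = b"
    and g_rec: "\<And>n \<omega>. 3 \<le> n \<Longrightarrow> \<omega> \<in> space M \<Longrightarrow>
      g n \<omega> = (if coin n \<omega> then \<bar>lam * g (n - 1) \<omega> + g (n - 2) \<omega>\<bar>
               else \<bar>lam * g (n - 1) \<omega> - g (n - 2) \<omega>\<bar>)"

end

theory Submission
  imports Defs
begin

text \<open>
  As \<open>lam \<ge> 2\<close>, the relation \<open>g (n - 1) \<le> g n\<close> is preserved by every step, and it is forced by any
  \<open>+\<close>; before it first holds, all terms stay below \<open>max a b\<close>. Hence the absolute value matters only on
  an event on which the terms are bounded, and the expectations satisfy
  \<open>m n = lam * m (n - 1) + (2 * p - 1) * m (n - 2) + e n\<close> with \<open>e\<close> nonnegative and bounded.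
  With \<open>\<alpha> > 1 > \<bar>\<beta>\<bar>\<close> the roots of the characteristic polynomial, \<open>(m (n + 1) - \<beta> * m n) / \<alpha> ^ n\<close> is
  increasing and bounded, so it converges, and its limit is positive because
  \<open>m (n + 1) - \<beta> * m n > 0\<close> once \<open>(1 - p) ^ n\<close> is small.
\<close>

section \<open>Linear recurrences with a bounded nonnegative perturbation\<close>

text \<open>The combinations \<open>d\<close> and \<open>f\<close> decouple the recurrence into
  first-order ones with multipliers \<alpha> and \<beta>. Since \<open>f\<close> stays bounded,
  \<open>m n\<close>, which is \<open>(d n - f n) / (\<alpha> - \<beta>)\<close>, grows like a
  positive constant times \<open>\<alpha> ^ n\<close>.\<close>

lemma perturbed_recurrence_ratio_tendsto:
  fixes m e :: "nat \<Rightarrow> real" and \<alpha> \<beta> K :: real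
  assumes "1 < \<alpha>" and "\<bar>\<beta>\<bar> < 1"
    and rec: "\<And>n. m (n + 2) = (\<alpha> + \<beta>) * m (n + 1) - \<alpha> * \<beta> * m n + e n"
    and e_nonneg: "\<And>n. 0 \<le> e n" and e_le: "\<And>n. e n \<le> K"
    and pos: "m (N + 1) - \<beta> * m N > 0"
  shows "(\<lambda>n. m (n + 1) / m n) \<longlonglongrightarrow> \<alpha>"
proof -
  define d where "d n = m (n + 1) - \<beta> * m n" for n
  define f where "f n = m (n + 1) - \<alpha> * m n" for n
  have d_Suc: "d (Suc n) = \<alpha> * d n + e n" and f_Suc: "f (Suc n) = \<beta> * f n + e n" for n
    using rec[of n] by (simp_all add: d_def f_def algebra_simps)
  have "0 < \<alpha>" "0 \<le> K"
    using assms(1) order_trans[OF e_nonneg e_le] by auto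
  \<comment> \<open>This \<open>B\<close> solves \<alpha> * B = B + K: adding it to \<open>d\<close>
    absorbs every perturbation up to \<open>K\<close>, which turns the increasing quotient into a
    decreasing one and so bounds it.\<close>
  define B where "B = K / (\<alpha> - 1)"
  have "0 \<le> B" and B: "\<alpha> * B = B + K"
    using \<open>0 \<le> K\<close> \<open>1 < \<alpha>\<close> by (auto simp: B_def field_simps)
  have inc: "incseq (\<lambda>n. d n / \<alpha> ^ n)"
    using \<open>0 < \<alpha>\<close> e_nonneg by (intro incseq_SucI) (simp add: d_Suc field_simps)
  have dec: "decseq (\<lambda>n. (d n + B) / \<alpha> ^ n)"
  proof (rule decseq_SucI)
    fix n
    have "d (Suc n) + B \<le> \<alpha> * (d n + B)"
      using e_le[of n] B by (simp add: d_Suc algebra_simps)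
    then have "(d (Suc n) + B) / \<alpha> ^ Suc n \<le> (\<alpha> * (d n + B)) / \<alpha> ^ Suc n"
      using \<open>0 < \<alpha>\<close> by (intro divide_right_mono) auto
    then show "(d (Suc n) + B) / \<alpha> ^ Suc n \<le> (d n + B) / \<alpha> ^ n"
      using \<open>0 < \<alpha>\<close> by simp
  qed
  have "d n / \<alpha> ^ n \<le> d 0 + B" for n
  proof -
    have "d n / \<alpha> ^ n \<le> (d n + B) / \<alpha> ^ n"
      using \<open>0 \<le> B\<close> \<open>0 < \<alpha>\<close> by (simp add: divide_right_mono)
    also have "\<dots> \<le> d 0 + B"
      using decseqD[OF dec, of 0 n] by simp
    finally show ?thesis .
  qed
  then obtain L where L: "(\<lambda>n. d n / \<alpha> ^ n) \<longlonglongrightarrow> L" and L_ge: "\<And>n. d n / \<alpha> ^ n \<le> L"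
    using incseq_convergent[OF inc, of "d 0 + B"] by auto
  \<comment> \<open>One positive value is enough, because the increasing sequence stays below its
    limit \<open>L\<close>.\<close>
  have "0 < d N / \<alpha> ^ N"
    using pos \<open>0 < \<alpha>\<close> by (simp add: d_def)
  then have "0 < L"
    using L_ge[of N] by linarith
  \<comment> \<open>Chosen so that the map x to \<bar>\<beta>\<bar> * x + K sends values up to
    \<open>F\<close> to values up to \<open>F\<close>; the summand \<bar>f 0\<bar> covers the start
    of the induction.\<close>
  define F where "F = \<bar>f 0\<bar> + K / (1 - \<bar>\<beta>\<bar>)"
  have "K \<le> (1 - \<bar>\<beta>\<bar>) * F"
    using \<open>\<bar>\<beta>\<bar> < 1\<close> by (simp add: F_def distrib_left)
  then have F: "\<bar>\<beta>\<bar> * F + K \<le> F"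
    by (simp add: algebra_simps)
  have f_le: "\<bar>f n\<bar> \<le> F" for n
  proof (induction n)
    case 0
    show ?case using \<open>0 \<le> K\<close> \<open>\<bar>\<beta>\<bar> < 1\<close> by (simp add: F_def)
  next
    case (Suc n)
    have "\<bar>f (Suc n)\<bar> \<le> \<bar>\<beta>\<bar> * \<bar>f n\<bar> + e n"
      using e_nonneg[of n] abs_triangle_ineq[of "\<beta> * f n" "e n"] by (simp add: f_Suc abs_mult)
    also have "\<dots> \<le> \<bar>\<beta>\<bar> * F + K"
      using Suc e_le[of n] by (intro add_mono mult_left_mono) auto
    finally show ?case using F by linarith
  qed
  have "(\<lambda>n. F * (1 / \<alpha>) ^ n) \<longlonglongrightarrow> 0"
    using \<open>1 < \<alpha>\<close> by (intro tendsto_mult_right_zero LIMSEQ_power_zero) auto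
  then have f_lim: "(\<lambda>n. f n / \<alpha> ^ n) \<longlonglongrightarrow> 0"
    using f_le \<open>0 < \<alpha>\<close>
    by (rule_tac Lim_null_comparison[rotated])
      (auto simp: power_divide divide_right_mono)
  have "\<alpha> \<noteq> \<beta>" using assms(1,2) by auto
  then have m_eq: "m n / \<alpha> ^ n = (d n / \<alpha> ^ n - f n / \<alpha> ^ n) / (\<alpha> - \<beta>)" for n
    using \<open>0 < \<alpha>\<close> by (simp add: d_def f_def field_simps)
  have "(\<lambda>n. m n / \<alpha> ^ n) \<longlonglongrightarrow> (L - 0) / (\<alpha> - \<beta>)"
    unfolding m_eq using \<open>\<alpha> \<noteq> \<beta>\<close> by (intro tendsto_intros L f_lim) auto
  then have u: "(\<lambda>n. m n / \<alpha> ^ n) \<longlonglongrightarrow> L / (\<alpha> - \<beta>)"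
    by simp
  \<comment> \<open>The leading \<alpha> compensates for the different exponents. If some
    \<open>m n\<close> is 0, both this expression and the plain quotient are 0 by the convention for
    division, so they agree for every \<open>n\<close>.\<close>
  have "(\<lambda>n. \<alpha> * ((m (n + 1) / \<alpha> ^ (n + 1)) / (m n / \<alpha> ^ n))) \<longlonglongrightarrow> \<alpha> * ((L / (\<alpha> - \<beta>)) / (L / (\<alpha> - \<beta>)))"
    using \<open>0 < L\<close> \<open>\<alpha> \<noteq> \<beta>\<close> by (intro tendsto_intros u LIMSEQ_ignore_initial_segment[OF u]) auto
  then show ?thesis
    using \<open>0 < L\<close> \<open>\<alpha> \<noteq> \<beta>\<close> \<open>0 < \<alpha>\<close> by simp
qed

text \<open>Here \<open>lam - \<alpha>\<close> is the second root of x^2 - lam x - (2 p - 1). It has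
  modulus below 1 iff the square root lies strictly between lam - 2 and lam + 2. Squared, the lower
  bound reads 2 - lam < 2 p, which is where \<open>0 < p\<close> enters: for lam = 2 and p = 0 both
  roots would be 1.\<close>

lemma characteristic_roots:
  fixes lam p :: real
  assumes "2 \<le> lam" and "0 < p" and "p \<le> 1"
  defines "\<alpha> \<equiv> (lam + sqrt (lam\<^sup>2 + 4 * (2 * p - 1))) / 2"
  shows "1 < \<alpha>" and "\<bar>lam - \<alpha>\<bar> < 1" and "\<alpha> * (lam - \<alpha>) = 1 - 2 * p"
proof -
  define s where "s = sqrt (lam\<^sup>2 + 4 * (2 * p - 1))"
  have "2\<^sup>2 \<le> lam\<^sup>2"
    using assms(1) by (intro power_mono) auto
  then have D: "0 < lam\<^sup>2 + 4 * (2 * p - 1)"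
    using assms(2) by simp
  then have "0 < s" and s2: "s\<^sup>2 = lam\<^sup>2 + 4 * (2 * p - 1)"
    by (auto simp: s_def)
  have lo: "lam - 2 < s"
    by (rule power2_less_imp_less) (use assms \<open>0 < s\<close> in \<open>auto simp: s2 power2_diff\<close>)
  have hi: "s < lam + 2"
    by (rule power2_less_imp_less) (use assms in \<open>auto simp: s2 power2_sum\<close>)
  have \<alpha>: "\<alpha> = (lam + s) / 2"
    by (simp add: \<alpha>_def s_def)
  show "1 < \<alpha>" "\<bar>lam - \<alpha>\<bar> < 1"
    using \<open>0 < s\<close> lo hi assms(1) by (auto simp: \<alpha> abs_if field_simps)
  show "\<alpha> * (lam - \<alpha>) = 1 - 2 * p"
    using s2 by (simp add: \<alpha> field_simps power2_eq_square)
qed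

section \<open>The terms as functions of finitely many coins\<close>

text \<open>A deterministic copy of \<open>g\<close> with the coin sequence as an argument. It
  exhibits \<open>g n\<close> as a measurable function of earlier coins, which is what independence
  arguments need. The value at index 0 is arbitrary.\<close>

fun fib_of_coins :: "real \<Rightarrow> real \<Rightarrow> real \<Rightarrow> nat \<Rightarrow> (nat \<Rightarrow> bool) \<Rightarrow> real" where
  "fib_of_coins lam a b 0 x = 0"
| "fib_of_coins lam a b (Suc 0) x = a"
| "fib_of_coins lam a b (Suc (Suc 0)) x = b"
| "fib_of_coins lam a b (Suc (Suc (Suc n))) x =
    (if x (Suc (Suc (Suc n)))
     then \<bar>lam * fib_of_coins lam a b (Suc (Suc n)) x + fib_of_coins lam a b (Suc n) x\<bar>
     else \<bar>lam * fib_of_coins lam a b (Suc (Suc n)) x - fib_of_coins lam a b (Suc n) x\<bar>)"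

lemma measurable_fib_of_coins:
  "n < N \<Longrightarrow> fib_of_coins lam a b n \<in> borel_measurable (PiM {3..<N} (\<lambda>_. count_space UNIV))"
proof (induction lam a b n "undefined :: nat \<Rightarrow> bool" rule: fib_of_coins.induct)
  case (4 lam a b n)
  have [measurable]: "fib_of_coins lam a b (Suc (Suc n)) \<in> borel_measurable (PiM {3..<N} (\<lambda>_. count_space UNIV))"
    "fib_of_coins lam a b (Suc n) \<in> borel_measurable (PiM {3..<N} (\<lambda>_. count_space UNIV))"
    using 4 by auto
  have [measurable]: "(\<lambda>x. x (Suc (Suc (Suc n)))) \<in> measurable (PiM {3..<N} (\<lambda>_. count_space UNIV)) (count_space (UNIV :: bool set))"
    using 4(5) by (intro measurable_component_singleton) auto
  have "fib_of_coins lam a b (Suc (Suc (Suc n))) = (\<lambda>x.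
    if x (Suc (Suc (Suc n)))
    then \<bar>lam * fib_of_coins lam a b (Suc (Suc n)) x + fib_of_coins lam a b (Suc n) x\<bar>
    else \<bar>lam * fib_of_coins lam a b (Suc (Suc n)) x - fib_of_coins lam a b (Suc n) x\<bar>)"
    by (rule ext) simp
  also have "\<dots> \<in> borel_measurable (PiM {3..<N} (\<lambda>_. count_space UNIV))"
    by measurable
  finally show ?case .
qed (simp_all cong: measurable_cong)

context random_fibonacci
begin

lemma g_step:
  "\<omega> \<in> space M \<Longrightarrow> 1 \<le> n \<Longrightarrow> g (n + 2) \<omega> =
    (if coin (n + 2) \<omega> then \<bar>lam * g (n + 1) \<omega> + g n \<omega>\<bar> else \<bar>lam * g (n + 1) \<omega> - g n \<omega>\<bar>)"
  using g_rec[of "n + 2" \<omega>] by (simp add: numeral_eq_Suc)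

text \<open>Only coins with indices from 3 to \<open>n\<close> are read, so the restriction,
  \<open>undefined\<close> elsewhere, loses nothing.\<close>

lemma g_eq_fib_of_coins:
  assumes "\<omega> \<in> space M" and "1 \<le> n" and "n < N"
  shows "g n \<omega> = fib_of_coins lam a b n (restrict (\<lambda>i. coin i \<omega>) {3..<N})"
  using assms(2,3)
proof (induction n rule: less_induct)
  case (less n)
  consider "n = 1" | "n = 2" | "3 \<le> n"
    using less.prems by linarith
  then show ?case
  proof cases
    case 3
    then obtain k where "n = Suc (Suc (Suc k))"
      using le_Suc_ex[of 3 n] by auto
    then show ?thesis
      using less.IH[of "Suc (Suc k)"] less.IH[of "Suc k"] less.prems g_step[OF assms(1), of "Suc k"]
      by simp
  qed (use g_1 g_2 assms(1) in \<open>auto simp: numeral_2_eq_2\<close>)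
qed

lemma coin_random_variable [measurable]: "3 \<le> n \<Longrightarrow> coin n \<in> measurable M (count_space UNIV)"
  using indep_coin by (auto simp: indep_vars_def)

lemma random_variable_g:
  assumes "1 \<le> n"
  shows "g n \<in> borel_measurable M"
proof -
  have "(\<lambda>\<omega>. restrict (\<lambda>i. coin i \<omega>) {3..<Suc n}) \<in> measurable M (PiM {3..<Suc n} (\<lambda>_. count_space UNIV))"
    by (intro measurable_restrict) auto
  then have "(\<lambda>\<omega>. fib_of_coins lam a b n (restrict (\<lambda>i. coin i \<omega>) {3..<Suc n})) \<in> borel_measurable M"
    using measurable_fib_of_coins[of n "Suc n" lam a b] by (auto intro: measurable_compose)
  then show ?thesis
    using assms by (subst measurable_cong[OF g_eq_fib_of_coins[of _ n "Suc n"]]) auto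
qed

section \<open>Independence of a coin from the past\<close>

text \<open>The variable \<open>X\<close> is determined by the coins before \<open>n\<close>, hence
  independent of coin \<open>n\<close>, and the expectation of the product factorises.\<close>

lemma expectation_coin_mult:
  assumes "3 \<le> n"
    and h: "h \<in> borel_measurable (PiM {3..<n} (\<lambda>_. count_space UNIV))"
    and X: "\<And>\<omega>. \<omega> \<in> space M \<Longrightarrow> X \<omega> = h (restrict (\<lambda>i. coin i \<omega>) {3..<n})"
    and "integrable M X"
  shows "expectation (\<lambda>\<omega>. of_bool (coin n \<omega>) * X \<omega>) = p * expectation X"
proof -
  let ?Y = "\<lambda>\<omega>. of_bool (coin n \<omega>) :: real"
  let ?R = "\<lambda>\<omega>. restrict (\<lambda>i. coin i \<omega>)"
  \<comment> \<open>Disjoint blocks of coins are independent; the one-element block is then read off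
    by evaluation at \<open>n\<close>.\<close>
  have "indep_var (PiM {n} (\<lambda>_. count_space UNIV)) (\<lambda>\<omega>. ?R \<omega> {n})
    (PiM {3..<n} (\<lambda>_. count_space UNIV)) (\<lambda>\<omega>. ?R \<omega> {3..<n})"
    using assms(1) by (intro indep_var_restrict[OF indep_coin]) auto
  moreover have "(\<lambda>x. of_bool (x n) :: real) \<in> borel_measurable (PiM {n} (\<lambda>_. count_space UNIV))"
    by measurable
  ultimately have "indep_var borel ((\<lambda>x. of_bool (x n)) \<circ> (\<lambda>\<omega>. ?R \<omega> {n})) borel (h \<circ> (\<lambda>\<omega>. ?R \<omega> {3..<n}))"
    using h by (intro indep_var_compose) auto
  moreover have "((\<lambda>x. of_bool (x n)) \<circ> (\<lambda>\<omega>. ?R \<omega> {n})) = ?Y"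
    by (auto simp: fun_eq_iff)
  ultimately have ind: "indep_var borel ?Y borel (\<lambda>\<omega>. h (?R \<omega> {3..<n}))"
    by (simp add: o_def)
  have [measurable]: "coin n \<in> measurable M (count_space UNIV)"
    using assms(1) by simp
  have "integrable M ?Y"
    by (rule integrable_const_bound[where B = 1]) auto
  moreover have "integrable M (\<lambda>\<omega>. h (?R \<omega> {3..<n}))"
    using assms(4) by (simp add: X cong: Bochner_Integration.integrable_cong)
  ultimately have "expectation (\<lambda>\<omega>. ?Y \<omega> * h (?R \<omega> {3..<n})) = expectation ?Y * expectation (\<lambda>\<omega>. h (?R \<omega> {3..<n}))"
    by (intro indep_var_lebesgue_integral ind) auto
  moreover have "expectation ?Y = p"
  proof -
    have "expectation ?Y = expectation (indicator {\<omega> \<in> space M. coin n \<omega>})"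
      by (intro Bochner_Integration.integral_cong) (auto simp: indicator_def)
    then show ?thesis using prob_coin[OF assms(1)] by simp
  qed
  ultimately show ?thesis
    using X by (simp cong: Bochner_Integration.integral_cong)
qed

text \<open>The coins 3 to \<open>n\<close> number \<open>n - 2\<close>. In the induction the
  indicator of one more tail is \<open>?X\<close> minus coin times \<open>?X\<close>, so its
  expectation is \<open>1 - p\<close> times that of \<open>?X\<close>.\<close>

lemma prob_all_tails:
  assumes "2 \<le> n"
  shows "prob {\<omega> \<in> space M. \<forall>i\<in>{3..n}. \<not> coin i \<omega>} = (1 - p) ^ (n - 2)"
  using assms
proof (induction n rule: dec_induct)
  case base
  then show ?case by (simp add: prob_space)
next
  case (step n)
  let ?T = "\<lambda>n. {\<omega> \<in> space M. \<forall>i\<in>{3..n}. \<not> coin i \<omega>}"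
  let ?X = "\<lambda>\<omega>. of_bool (\<forall>i\<in>{3..n}. \<not> coin i \<omega>) :: real"
  have T [measurable]: "?T k \<in> sets M" for k
  proof -
    have "Measurable.pred M (coin i)" if "i \<in> {3..k}" for i
      using that by simp
    then show ?thesis by measurable
  qed
  have pr: "prob (?T k) = expectation (\<lambda>\<omega>. of_bool (\<forall>i\<in>{3..k}. \<not> coin i \<omega>))" for k
  proof -
    have "expectation (\<lambda>\<omega>. of_bool (\<forall>i\<in>{3..k}. \<not> coin i \<omega>)) = expectation (indicator (?T k))"
      by (intro Bochner_Integration.integral_cong) (auto simp: indicator_def)
    also have "\<dots> = prob (?T k)"
      using T[of k] by (subst Bochner_Integration.integral_indicator) (auto simp: Int_absorb2)
    finally show ?thesis ..
  qed
  have [measurable]: "Measurable.pred M (coin i)" if "i \<in> {3..Suc n}" for i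
    using that by simp
  have X: "?X \<in> borel_measurable M"
    by measurable
  then have int: "integrable M ?X"
    by (intro integrable_const_bound[where B = 1]) auto
  have h: "(\<lambda>x. of_bool (\<forall>i\<in>{3..n}. \<not> x i) :: real) \<in> borel_measurable (PiM {3..<Suc n} (\<lambda>_. count_space UNIV))"
  proof -
    have "Measurable.pred (PiM {3..<Suc n} (\<lambda>_. count_space UNIV)) (\<lambda>x. x i)" if "i \<in> {3..n}" for i
      using that by (intro measurable_component_singleton) auto
    then show ?thesis by measurable
  qed
  have "expectation (\<lambda>\<omega>. of_bool (coin (Suc n) \<omega>) * ?X \<omega>) = p * expectation ?X"
    using step.hyps int by (intro expectation_coin_mult[OF _ h]) auto
  moreover have "integrable M (\<lambda>\<omega>. of_bool (coin (Suc n) \<omega>) * ?X \<omega>)"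
    using step.hyps X by (intro integrable_const_bound[where B = 1]) auto
  moreover have "(\<lambda>\<omega>. of_bool (\<forall>i\<in>{3..Suc n}. \<not> coin i \<omega>)) = (\<lambda>\<omega>. ?X \<omega> - of_bool (coin (Suc n) \<omega>) * ?X \<omega>)"
    using step.hyps by (auto simp: fun_eq_iff atLeastAtMostSuc_conv)
  ultimately have "prob (?T (Suc n)) = expectation ?X - p * expectation ?X"
    using int by (simp only: pr Bochner_Integration.integral_diff)
  then have "prob (?T (Suc n)) = (1 - p) * prob (?T n)"
    by (simp only: pr left_diff_distrib mult_1)
  moreover have "Suc n - 2 = Suc (n - 2)"
    using step.hyps by linarith
  ultimately show ?case
    using step.IH by (simp only: power_Suc)
qed

section \<open>Estimates along each path\<close>

lemma g_nonneg: "\<omega> \<in> space M \<Longrightarrow> 1 \<le> n \<Longrightarrow> 0 \<le> g n \<omega>"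
proof -
  assume \<omega>: "\<omega> \<in> space M" and "1 \<le> n"
  then consider "n = 1" | "n = 2" | "3 \<le> n" by linarith
  then show ?thesis
    by cases (use \<omega> initial_pos g_1 g_2 g_rec in auto)
qed

text \<open>For successive terms x, y, z: if x \<le> y, then z \<ge> lam y - x \<ge> y, and a head
  gives z = lam y + x \<ge> y in any case. So the increasing alternative persists, and the other one
  survives only tails.\<close>

lemma increasing_or_all_tails:
  assumes "2 \<le> lam" and \<omega>: "\<omega> \<in> space M" and "1 \<le> n"
  shows "g n \<omega> \<le> g (n + 1) \<omega> \<or>
    (\<forall>i\<in>{3..n + 1}. \<not> coin i \<omega>) \<and> g n \<omega> \<le> max a b \<and> g (n + 1) \<omega> \<le> max a b"
  using assms(3)
proof (induction n rule: dec_induct)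
  case base
  then show ?case using g_1[OF \<omega>] g_2[OF \<omega>] by (simp add: numeral_2_eq_2)
next
  case (step n)
  define x y z where "x = g n \<omega>" and "y = g (n + 1) \<omega>" and "z = g (n + 2) \<omega>"
  have "0 \<le> x" "0 \<le> y"
    using g_nonneg[OF \<omega>] step.hyps by (auto simp: x_def y_def)
  then have ly: "2 * y \<le> lam * y"
    using assms(1) by (intro mult_right_mono)
  have z: "z = (if coin (n + 2) \<omega> then \<bar>lam * y + x\<bar> else \<bar>lam * y - x\<bar>)"
    using g_step[OF \<omega>] step.hyps by (simp add: x_def y_def z_def)
  have "x \<le> y \<or> (\<forall>i\<in>{3..n + 1}. \<not> coin i \<omega>) \<and> x \<le> max a b \<and> y \<le> max a b"
    using step.IH by (simp add: x_def y_def)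
  then have "y \<le> z \<or> ((\<forall>i\<in>{3..n + 1}. \<not> coin i \<omega>) \<and> \<not> coin (n + 2) \<omega>) \<and> y \<le> max a b \<and> z \<le> max a b"
  proof (elim disjE)
    assume "x \<le> y"
    then show ?thesis using z ly \<open>0 \<le> x\<close> by (auto simp: abs_if)
  next
    assume *: "(\<forall>i\<in>{3..n + 1}. \<not> coin i \<omega>) \<and> x \<le> max a b \<and> y \<le> max a b"
    show ?thesis
    proof (cases "coin (n + 2) \<omega>")
      case True
      then show ?thesis using z ly \<open>0 \<le> x\<close> \<open>0 \<le> y\<close> by simp
    next
      case False
      \<comment> \<open>If lam y < x, then z = x - lam y \<le> x \<le> max a b; otherwise either y
        \<le> z or z < y \<le> max a b.\<close>
      then have "y \<le> z \<or> z \<le> max a b"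
        using z ly \<open>0 \<le> y\<close> * by (auto simp: abs_if)
      then show ?thesis using * False by blast
    qed
  qed
  moreover have "{3..Suc n + 1} = insert (n + 2) {3..n + 1}"
    using step.hyps by auto
  ultimately show ?case by (auto simp: y_def z_def)
qed

text \<open>A crude exponential bound, meant only to give integrability.\<close>

lemma g_bounded:
  assumes "2 \<le> lam" and \<omega>: "\<omega> \<in> space M" and "1 \<le> n"
  shows "g n \<omega> \<le> max a b * (lam + 1) ^ n"
  using assms(3)
proof (induction n rule: less_induct)
  case (less n)
  let ?C = "max a b"
  have "0 < ?C" using initial_pos by auto
  consider "n = 1" | "n = 2" | "3 \<le> n"
    using less.prems by linarith
  then show ?case
  proof cases
    case 3
    define k where "k = n - 2"
    have k: "n = k + 2" "1 \<le> k"
      using 3 by (simp_all add: k_def)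
    have IH: "g (k + 1) \<omega> \<le> ?C * (lam + 1) ^ (k + 1)" "g k \<omega> \<le> ?C * (lam + 1) ^ k"
      using less.IH[of "k + 1"] less.IH[of k] k by simp_all
    have "0 \<le> g k \<omega>" "0 \<le> g (k + 1) \<omega>"
      using k by (auto intro: g_nonneg[OF \<omega>])
    moreover from this have "0 \<le> lam * g (k + 1) \<omega>"
      using assms(1) by simp
    ultimately have "g n \<omega> \<le> lam * g (k + 1) \<omega> + g k \<omega>"
      using g_step[OF \<omega> k(2)] k(1) by (auto simp: abs_if)
    also have "\<dots> \<le> lam * (?C * (lam + 1) ^ (k + 1)) + ?C * (lam + 1) ^ (k + 1)"
    proof (intro add_mono mult_left_mono IH)
      show "g k \<omega> \<le> ?C * (lam + 1) ^ (k + 1)"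
        using IH(2) \<open>0 < ?C\<close> assms(1)
        by (rule_tac order_trans[OF _ mult_left_mono[OF power_increasing[of k "k + 1" "lam + 1"]]]) auto
    qed (use assms(1) in auto)
    also have "\<dots> = ?C * (lam + 1) ^ n"
      by (simp add: k(1) algebra_simps)
    finally show ?thesis .
  next
    case 1
    then show ?thesis
      using g_1[OF \<omega>] mult_mono[of a ?C 1 "lam + 1"] initial_pos assms(1) by auto
  next
    case 2
    then show ?thesis
      using g_2[OF \<omega>] mult_mono[of b ?C 1 "(lam + 1)\<^sup>2"] initial_pos assms(1) by (auto simp: one_le_power)
  qed
qed

section \<open>Expectations: recurrence and bounds\<close>

lemma integrable_g:
  assumes "2 \<le> lam" and "1 \<le> n"
  shows "integrable M (g n)"
  using g_bounded[OF assms(1) _ assms(2)] g_nonneg[OF _ assms(2)] random_variable_g[OF assms(2)]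
  by (intro integrable_const_bound[where B = "max a b * (lam + 1) ^ n"]) auto

text \<open>With x = \<open>g n\<close> and y = \<open>g (n + 1)\<close>, a tail gives \<bar>lam y -
  x\<bar> = lam y - x + 2 max 0 (x - lam y). A head exceeds this by an amount depending only on
  earlier coins, so its contribution is weighted by \<open>p\<close>.\<close>

lemma expectation_g_step:
  assumes "2 \<le> lam" and "1 \<le> n"
  shows "expectation (g (n + 2)) =
    lam * expectation (g (n + 1)) + (2 * p - 1) * expectation (g n)
    + 2 * (1 - p) * expectation (\<lambda>\<omega>. max 0 (g n \<omega> - lam * g (n + 1) \<omega>))"
proof -
  let ?N = "n + 2"
  let ?r = "\<lambda>\<omega>. restrict (\<lambda>i. coin i \<omega>) {3..<?N}"
  \<comment> \<open>This is the minimum of \<open>g n\<close> and \<open>lam * g (n + 1)\<close>,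
    half the gap between the outcomes for + and -; \<open>h\<close> expresses it through the
    coins.\<close>
  define D where "D \<omega> = g n \<omega> - max 0 (g n \<omega> - lam * g (n + 1) \<omega>)" for \<omega>
  define h where "h x = fib_of_coins lam a b n x
    - max 0 (fib_of_coins lam a b n x - lam * fib_of_coins lam a b (n + 1) x)" for x
  have [measurable]: "fib_of_coins lam a b n \<in> borel_measurable (PiM {3..<?N} (\<lambda>_. count_space UNIV))"
    "fib_of_coins lam a b (n + 1) \<in> borel_measurable (PiM {3..<?N} (\<lambda>_. count_space UNIV))"
    by (auto intro: measurable_fib_of_coins)
  have h: "h \<in> borel_measurable (PiM {3..<?N} (\<lambda>_. count_space UNIV))"
    unfolding h_def by measurable
  have D: "D \<omega> = h (?r \<omega>)" if "\<omega> \<in> space M" for \<omega>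
    using assms(2) g_eq_fib_of_coins[OF that, of n ?N] g_eq_fib_of_coins[OF that, of "n + 1" ?N]
    by (simp add: D_def h_def)
  have int: "integrable M (g n)" "integrable M (g (n + 1))"
    using assms integrable_g by auto
  have int_max: "integrable M (\<lambda>\<omega>. max 0 (g n \<omega> - lam * g (n + 1) \<omega>))"
    by (intro integrable_max Bochner_Integration.integrable_diff integrable_mult_right int integrable_const)
  have int_D: "integrable M D"
    unfolding D_def by (intro Bochner_Integration.integrable_diff int int_max)
  have [measurable]: "coin ?N \<in> measurable M (count_space UNIV)"
    using assms(2) by simp
  have int_cD: "integrable M (\<lambda>\<omega>. of_bool (coin ?N \<omega>) * D \<omega>)"
  proof (rule Bochner_Integration.integrable_bound[OF int_D])
    have [measurable]: "D \<in> borel_measurable M"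
      using int_D by (rule borel_measurable_integrable)
    show "(\<lambda>\<omega>. of_bool (coin ?N \<omega>) * D \<omega>) \<in> borel_measurable M"
      by measurable
  qed auto
  have split: "g ?N \<omega> = lam * g (n + 1) \<omega> - g n \<omega> + 2 * max 0 (g n \<omega> - lam * g (n + 1) \<omega>)
      + 2 * (of_bool (coin ?N \<omega>) * D \<omega>)" if "\<omega> \<in> space M" for \<omega>
  proof -
    have "0 \<le> g n \<omega>" "0 \<le> g (n + 1) \<omega>"
      using assms(2) by (auto intro: g_nonneg[OF that])
    moreover from this have "0 \<le> lam * g (n + 1) \<omega>"
      using assms(1) by simp
    ultimately show ?thesis
      using g_step[OF that assms(2)] by (auto simp: D_def max_def abs_if)
  qed
  have "expectation (g ?N) = expectation (\<lambda>\<omega>. lam * g (n + 1) \<omega> - g n \<omega>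
      + 2 * max 0 (g n \<omega> - lam * g (n + 1) \<omega>) + 2 * (of_bool (coin ?N \<omega>) * D \<omega>))"
    by (intro Bochner_Integration.integral_cong split) auto
  also have "\<dots> = lam * expectation (g (n + 1)) - expectation (g n)
      + 2 * expectation (\<lambda>\<omega>. max 0 (g n \<omega> - lam * g (n + 1) \<omega>)) + 2 * (p * expectation D)"
    using assms(2) int int_max int_cD
    by (subst expectation_coin_mult[OF _ h D int_D, symmetric])
      auto
  also have "expectation D = expectation (g n) - expectation (\<lambda>\<omega>. max 0 (g n \<omega> - lam * g (n + 1) \<omega>))"
    unfolding D_def using int int_max by simp
  finally show ?thesis
    by (simp add: algebra_simps)
qed

text \<open>If g n \<le> g (n + 1), then lam * g (n + 1) \<ge> g n and the maximum is 0; otherwise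
  \<open>g n\<close> itself is at most \<open>max a b\<close>.\<close>

lemma expectation_undershoot_bounds:
  assumes "2 \<le> lam" and "1 \<le> n"
  shows "expectation (\<lambda>\<omega>. max 0 (g n \<omega> - lam * g (n + 1) \<omega>)) \<in> {0..max a b}"
proof -
  let ?X = "\<lambda>\<omega>. max 0 (g n \<omega> - lam * g (n + 1) \<omega>)"
  have int: "integrable M ?X"
    using assms integrable_g
    by (intro integrable_max Bochner_Integration.integrable_diff integrable_mult_right integrable_const)
      auto
  have "?X \<omega> \<le> max a b" if "\<omega> \<in> space M" for \<omega>
  proof -
    have "0 \<le> g (n + 1) \<omega>"
      by (auto intro: g_nonneg[OF that])
    then have "2 * g (n + 1) \<omega> \<le> lam * g (n + 1) \<omega>"
      using assms(1) by (intro mult_right_mono)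
    then show ?thesis
      using increasing_or_all_tails[OF assms(1) that assms(2)] \<open>0 \<le> g (n + 1) \<omega>\<close> initial_pos by auto
  qed
  then have "expectation ?X \<le> max a b"
    using int by (intro integral_le_const) auto
  then show ?thesis by simp
qed

text \<open>A head at the first toss, of probability \<open>p\<close>, makes g 3 \<ge> b and rules
  out all tails, so the path never decreases afterwards. Elsewhere the terms are
  nonnegative.\<close>

lemma expectation_g_ge:
  assumes "2 \<le> lam" and "3 \<le> n"
  shows "p * b \<le> expectation (g n)"
proof -
  let ?A = "{\<omega> \<in> space M. coin 3 \<omega>}"
  have [measurable]: "coin 3 \<in> measurable M (count_space UNIV)"
    by simp
  have "b \<le> g n \<omega>" if "\<omega> \<in> ?A" for \<omega>
    using assms(2)
  proof (induction n rule: dec_induct)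
    case base
    have "b \<le> lam * b + a"
      using mult_right_mono[OF assms(1), of b] initial_pos by linarith
    then show ?case
      using that g_rec[of 3 \<omega>] g_1[of \<omega>] g_2[of \<omega>] by simp
  next
    case (step n)
    then show ?case
      using increasing_or_all_tails[OF assms(1), of \<omega> n] that by auto
  qed
  then have "expectation (\<lambda>\<omega>. indicator ?A \<omega> * b) \<le> expectation (g n)"
    using assms integrable_g g_nonneg
    by (intro integral_mono integrable_mult_left integrable_real_indicator)
      (auto simp: indicator_def less_top[symmetric])
  then show ?thesis
    using prob_coin[of 3] by simp
qed

text \<open>A decrease requires tails at all of the \<open>n - 1\<close> coins from 3 to
  \<open>n + 1\<close>, and then costs at most \<open>max a b\<close>.\<close>

lemma expectation_g_increment_ge:
  assumes "2 \<le> lam" and "1 \<le> n"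
  shows "expectation (g n) - max a b * (1 - p) ^ (n - 1) \<le> expectation (g (n + 1))"
proof -
  let ?T = "{\<omega> \<in> space M. \<forall>i\<in>{3..n + 1}. \<not> coin i \<omega>}"
  have "Measurable.pred M (coin i)" if "i \<in> {3..n + 1}" for i
    using that by simp
  then have T [measurable]: "?T \<in> sets M"
    by measurable
  have "expectation (\<lambda>\<omega>. g n \<omega> - indicator ?T \<omega> * max a b) \<le> expectation (g (n + 1))"
  proof (intro integral_mono Bochner_Integration.integrable_diff integrable_mult_left integrable_g
      integrable_real_indicator)
    fix \<omega> assume \<omega>: "\<omega> \<in> space M"
    show "g n \<omega> - indicator ?T \<omega> * max a b \<le> g (n + 1) \<omega>"
      using increasing_or_all_tails[OF assms(1) \<omega> assms(2)] g_nonneg[OF \<omega>, of "n + 1"] \<omega> initial_pos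
      by (auto simp: indicator_def)
  qed (use assms T in \<open>auto simp: less_top[symmetric]\<close>)
  moreover have "integrable M (\<lambda>\<omega>. indicator ?T \<omega> * max a b)"
    using T by (intro integrable_mult_left integrable_real_indicator) (auto simp: less_top[symmetric])
  moreover have "prob ?T = (1 - p) ^ (n - 1)"
    using prob_all_tails[of "n + 1"] assms(2) by (simp add: numeral_2_eq_2)
  ultimately show ?thesis
    using integrable_g[OF assms] T by (simp add: mult.commute)
qed

end

section \<open>Limit of the ratio of expectations\<close>

theorem theorem2:
  fixes M :: "'a measure" and p lam a b :: real
    and coin :: "nat \<Rightarrow> 'a \<Rightarrow> bool" and g :: "nat \<Rightarrow> 'a \<Rightarrow> real" and m :: "nat \<Rightarrow> real"
  assumes "random_fibonacci M p lam a b coin g"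
    and "2 \<le> lam" and "0 < p" and "p \<le> 1"
    and "\<And>n. 1 \<le> n \<Longrightarrow> m n = prob_space.expectation M (g n)"
  shows "(\<lambda>n. m (n + 1) / m n) \<longlonglongrightarrow> (lam + sqrt (lam\<^sup>2 + 4 * (2 * p - 1))) / 2"
proof -
  interpret random_fibonacci M p lam a b coin g
    by fact
  define \<alpha> where "\<alpha> = (lam + sqrt (lam\<^sup>2 + 4 * (2 * p - 1))) / 2"
  define \<beta> where "\<beta> = lam - \<alpha>"
  have roots: "1 < \<alpha>" "\<bar>\<beta>\<bar> < 1" "\<alpha> + \<beta> = lam" "\<alpha> * \<beta> = 1 - 2 * p"
    using characteristic_roots[OF assms(2-4)] by (simp_all add: \<alpha>_def \<beta>_def)
  define e where "e n = 2 * (1 - p) * expectation (\<lambda>\<omega>. max 0 (g (n + 1) \<omega> - lam * g (n + 2) \<omega>))" for n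
  have E: "expectation (\<lambda>\<omega>. max 0 (g (n + 1) \<omega> - lam * g (n + 2) \<omega>)) \<in> {0..max a b}" for n
    using expectation_undershoot_bounds[OF assms(2), of "n + 1"] by simp
  have e: "0 \<le> e n" "e n \<le> 2 * (1 - p) * max a b" for n
    unfolding e_def using E[of n] assms(4) by (auto intro!: mult_nonneg_nonneg mult_left_mono)
  \<comment> \<open>The value \<open>m 0\<close> is unconstrained, so the recurrence is stated for
    the shifted sequence n to \<open>m (n + 1)\<close>; the shift is undone at the end.\<close>
  have rec: "m (n + 2 + 1) = (\<alpha> + \<beta>) * m (n + 1 + 1) - \<alpha> * \<beta> * m (n + 1) + e n" for n
    using expectation_g_step[OF assms(2), of "n + 1"] assms(5)
    by (simp add: roots(3,4) e_def algebra_simps)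
  \<comment> \<open>Positivity for the shifted sequence: m (N + 2) - \<beta> * m (N + 1) is at least
    (1 - \<beta>) * m (N + 1) minus the loss max a b * (1 - p) ^ N, and the first term is at least
    (1 - \<beta>) * (p * b).\<close>
  have "0 < (1 - \<beta>) * (p * b)"
    using roots(2) assms(3) initial_pos by auto
  moreover have "(\<lambda>n. max a b * (1 - p) ^ n) \<longlonglongrightarrow> 0"
    using assms(3,4) by (intro tendsto_mult_right_zero LIMSEQ_power_zero) auto
  ultimately have "\<forall>\<^sub>F n in sequentially. max a b * (1 - p) ^ n < (1 - \<beta>) * (p * b)"
    by (rule order_tendstoD(2)[rotated])
  \<comment> \<open>With 2 \<le> N, the index \<open>N + 1\<close> is at least 3, as the lower bound
    p * b for the expectation demands.\<close>
  then obtain N where N: "2 \<le> N" "max a b * (1 - p) ^ N < (1 - \<beta>) * (p * b)"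
    unfolding eventually_sequentially by (meson max.cobounded1 max.cobounded2)
  have "m (N + 1) - max a b * (1 - p) ^ N \<le> m (N + 1 + 1)"
    using expectation_g_increment_ge[OF assms(2), of "N + 1"] assms(5) by simp
  moreover have "(1 - \<beta>) * (p * b) \<le> (1 - \<beta>) * m (N + 1)"
    using expectation_g_ge[OF assms(2), of "N + 1"] assms(5) N(1) roots(2)
    by (intro mult_left_mono) auto
  ultimately have "m (N + 1 + 1) - \<beta> * m (N + 1) > 0"
    using N(2) by (simp add: algebra_simps)
  then have "(\<lambda>n. m (n + 1 + 1) / m (n + 1)) \<longlonglongrightarrow> \<alpha>"
    by (rule perturbed_recurrence_ratio_tendsto[where m = "\<lambda>n. m (n + 1)", OF roots(1,2) rec e])
  then show ?thesis
    unfolding \<alpha>_def by (rule LIMSEQ_offset[where k = 1])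
qed

end
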